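(* Let $G$ be a finite simple undirected graph with $1\leq \delta(G)\leq 2$. Then $\gamma_t(G)=2\mu^*(G)$ if and only if there exists a maximal matching $M=M^+\cup M^-\cup M^*$ in $G$ satisfying the following conditions: (i) $M^+$ is a perfect matching of the subgraph of $G$ induced by $S^+(G)$. (ii) $S^-(G)\subseteq V(M^-)$, and every edge in $M^-$ joins a vertex from $S^-(G)$ and a vertex from $V(G)\setminus sup(G)$. (iii) For every $v\in S^-(G)\cup V(M^* )$, $M_p(v)$ is the unique neighbor of $v$ among the vertices in $V(M)$. (iv) For every two distinct vertices $u$ and $v$ in $S^-(G)\cup V(M^* )$, whenever $u$ and $v$ have a common neighbor in $G$, there exists a vertex of $G$ whose neighborhood is exactly $\{M_p(u),M_p(v)\}$.
   Context: $\delta(G)$ is the minimum degree of $G$. A set $S\subseteq V(G)$ is a total dominating set of $G$ if every vertex of $V(G)$ (including those in $S$) is adjacent to a member of $S$; $\gamma_t(G)$ is the minimum cardinality of a total dominating set (defined when $G$ has no isolated vertices). A matching is a set of pairwise disjoint edges; a maximal matching is a matching not contained in a larger matching; $\mu^*(G)$ is the minimum cardinality of a maximal matching of $G$. For a matching $M$, $V(M)$ is the set of endpoints of the edges in $M$, and for $w\in V(M)$, $M_p(w)$ denotes the other endpoint of the edge of $M$ containing $w$. A leaf is a vertex of degree one; a support vertex is a vertex adjacent to a leaf. $sup(G)$ is the set of all support vertices of $G$; $S^+(G)$ is the set of support vertices that are adjacent to some support vertex; $S^-(G)=sup(G)\setminus S^+(G)$. A matching of a graph is perfect if it covers all vertices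 of that graph (the empty matching is the perfect matching of the graph with no vertices). *)

theory Defs
  imports Main
begin

text \<open>A finite simple undirected graph is given by its vertex set \<open>V\<close> and its set \<open>E\<close> of edges,
  an edge being the two-element set of its endpoints.\<close>

definition simple_graph :: "'a set \<Rightarrow> 'a set set \<Rightarrow> bool" where
  "simple_graph V E \<longleftrightarrow> finite V \<and> (\<forall>e\<in>E. e \<subseteq> V \<and> card e = 2)"

definition nbhd :: "'a set set \<Rightarrow> 'a \<Rightarrow> 'a set" where
  "nbhd E v = {u. {u, v} \<in> E}"

definition vdegree :: "'a set set \<Rightarrow> 'a \<Rightarrow> nat" where
  "vdegree E v = card (nbhd E v)"

text \<open>Meaningful only for \<open>V \<noteq> {}\<close>.\<close>

definition min_degree :: "'a set \<Rightarrow> 'a set set \<Rightarrow> nat" where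
  "min_degree V E = Min (vdegree E ` V)"

definition induced_edges :: "'a set set \<Rightarrow> 'a set \<Rightarrow> 'a set set" where
  "induced_edges E S = {e \<in> E. e \<subseteq> S}"

definition total_dominating :: "'a set \<Rightarrow> 'a set set \<Rightarrow> 'a set \<Rightarrow> bool" where
  "total_dominating V E S \<longleftrightarrow> S \<subseteq> V \<and> (\<forall>v\<in>V. \<exists>u\<in>S. u \<in> nbhd E v)"

text \<open>Meaningful only for graphs without isolated vertices, since otherwise there is no total
  dominating set.\<close>

definition total_domination_number :: "'a set \<Rightarrow> 'a set set \<Rightarrow> nat" where
  "total_domination_number V E = Min (card ` {S. total_dominating V E S})"

definition matching :: "'a set set \<Rightarrow> 'a set set \<Rightarrow> bool" where
  "matching E M \<longleftrightarrow> M \<subseteq> E \<and> pairwise disjnt M"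

definition maximal_matching :: "'a set set \<Rightarrow> 'a set set \<Rightarrow> bool" where
  "maximal_matching E M \<longleftrightarrow> matching E M \<and> \<not> (\<exists>M'. matching E M' \<and> M \<subset> M')"

definition min_maximal_matching_number :: "'a set set \<Rightarrow> nat" where
  "min_maximal_matching_number E = Min (card ` {M. maximal_matching E M})"

definition perfect_matching :: "'a set \<Rightarrow> 'a set set \<Rightarrow> 'a set set \<Rightarrow> bool" where
  "perfect_matching V E M \<longleftrightarrow> matching E M \<and> \<Union>M = V"

text \<open>The vertex set of a matching \<open>M\<close> is \<open>\<Union>M\<close>; the partner of \<open>w\<close> in \<open>M\<close> is meaningful only for
  \<open>w \<in> \<Union>M\<close>.\<close>

definition partner :: "'a set set \<Rightarrow> 'a \<Rightarrow> 'a" where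
  "partner M w = (THE x. {w, x} \<in> M)"

definition leaf :: "'a set \<Rightarrow> 'a set set \<Rightarrow> 'a \<Rightarrow> bool" where
  "leaf V E v \<longleftrightarrow> v \<in> V \<and> vdegree E v = 1"

definition supports :: "'a set \<Rightarrow> 'a set set \<Rightarrow> 'a set" where
  "supports V E = {v \<in> V. \<exists>u. leaf V E u \<and> u \<in> nbhd E v}"

definition supports_plus :: "'a set \<Rightarrow> 'a set set \<Rightarrow> 'a set" where
  "supports_plus V E = {v \<in> supports V E. \<exists>u\<in>supports V E. u \<in> nbhd E v}"

definition supports_minus :: "'a set \<Rightarrow> 'a set set \<Rightarrow> 'a set" where
  "supports_minus V E = supports V E - supports_plus V E"

end

theory Submission
  imports Defs
begin

text \<open>The vertex set of a maximal matching is total dominating, so \<open>\<gamma>\<^sub>t \<le> 2 \<mu>\<^sup>*\<close>, and equality means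
  that the vertex set \<open>T\<close> of some maximal matching is a minimum total dominating set. In that case
  every \<open>y \<in> T\<close> has a private neighbour, which can only be a leaf or the partner of \<open>y\<close>; this gives
  conditions (i) to (iii). Replacing the partners of \<open>u\<close> and \<open>v\<close> by a common neighbour of \<open>u\<close> and
  \<open>v\<close> must leave some vertex undominated, which gives (iv).
  Conversely, let \<open>D\<close> be any total dominating set. It contains all supports, so each \<open>w \<in> T - D\<close> is
  the partner of a vertex satisfying (iii); sending \<open>w\<close> to a dominator of its partner is a map from
  \<open>T - D\<close> to \<open>D - T\<close>, injective by (iv), whence \<open>card T \<le> card D\<close>.\<close>

section \<open>Total dominating sets and matchings\<close>

lemma nbhd_sym: "u \<in> nbhd E v \<longleftrightarrow> v \<in> nbhd E u"
  by (simp add: nbhd_def insert_commute)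

lemma matching_edge_unique:
  assumes "matching E M" "{w, x} \<in> M" "{w, y} \<in> M"
  shows "x = y"
proof -
  have "\<not> disjnt {w, x} {w, y}" by (simp add: disjnt_def)
  then have "{w, x} = {w, y}"
    using assms pairwiseD[of disjnt M "{w, x}" "{w, y}"] unfolding matching_def by metis
  then show ?thesis by (auto simp: doubleton_eq_iff)
qed

lemma partner_eq:
  assumes "matching E M" "{w, x} \<in> M"
  shows "partner M w = x"
  unfolding partner_def using assms(2)
  by (rule the_equality) (rule matching_edge_unique[OF assms(1) _ assms(2)])

text \<open>The lower bound on the minimum degree enters through \<open>nbhd_nonempty\<close>: it
  makes \<open>V\<close> itself total dominating, so \<open>total_domination_number\<close> is a
  minimum over a nonempty set.\<close>

locale graph_without_isolated =
  fixes V :: "'a set" and E :: "'a set set"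
  assumes simple: "simple_graph V E"
    and nbhd_nonempty: "v \<in> V \<Longrightarrow> nbhd E v \<noteq> {}"
begin

lemma finite_V: "finite V"
  using simple by (simp add: simple_graph_def)

lemma finite_E: "finite E"
proof (rule finite_subset)
  show "E \<subseteq> Pow V" using simple by (auto simp: simple_graph_def)
qed (simp add: finite_V)

lemma nbhd_subset: "nbhd E v \<subseteq> V"
  using simple by (auto simp: simple_graph_def nbhd_def)

text \<open>Such a \<open>z\<close> is a leaf. Used mostly in contrapositive form: a vertex whose
  only neighbour is a non-support cannot exist.\<close>

lemma supports_nbhd_singleton:
  assumes "z \<in> V" "nbhd E z = {y}"
  shows "y \<in> supports V E"
proof -
  have "leaf V E z" using assms by (simp add: leaf_def vdegree_def)
  moreover have "z \<in> nbhd E y" using assms nbhd_sym[of y E z] by simp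
  moreover have "y \<in> V" using assms nbhd_subset[of z] by simp
  ultimately show ?thesis by (auto simp: supports_def)
qed

section \<open>Total dominating sets and the total domination number\<close>

lemma total_dominating_V: "total_dominating V E V"
  using nbhd_nonempty nbhd_subset unfolding total_dominating_def by blast

lemma finite_total_dominating: "finite {S. total_dominating V E S}"
  by (rule finite_subset[of _ "Pow V"]) (auto simp: total_dominating_def finite_V)

lemma total_domination_number_le:
  "total_dominating V E D \<Longrightarrow> total_domination_number V E \<le> card D"
  unfolding total_domination_number_def
  by (rule Min_le) (auto intro: finite_total_dominating)

lemma total_domination_number_attained:
  obtains D where "total_dominating V E D" "card D = total_domination_number V E"
proof -
  have "total_domination_number V E \<in> card ` {S. total_dominating V E S}"
    unfolding total_domination_number_def
    using total_dominating_V by (intro Min_in finite_imageI finite_total_dominating) auto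
  then show ?thesis using that by auto
qed

text \<open>A leaf can be dominated only by its single neighbour.\<close>

lemma supports_subset_total_dominating:
  assumes "total_dominating V E D"
  shows "supports V E \<subseteq> D"
proof
  fix v assume "v \<in> supports V E"
  then obtain u where u: "u \<in> V" "card (nbhd E u) = 1" "v \<in> nbhd E u"
    using nbhd_sym[of v] by (auto simp: supports_def leaf_def vdegree_def)
  then have "nbhd E u = {v}" by (auto simp: card_1_singleton_iff)
  then show "v \<in> D" using assms u(1) by (auto simp: total_dominating_def)
qed

section \<open>Maximal matchings and their minimum size\<close>

lemma finite_matchings: "finite {M. matching E M}"
  by (rule finite_subset[of _ "Pow E"]) (auto simp: matching_def finite_E)

lemma finite_maximal_matchings: "finite {M. maximal_matching E M}"
  by (rule finite_subset[OF _ finite_matchings]) (auto simp: maximal_matching_def)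

lemma maximal_matching_exists: "\<exists>M. maximal_matching E M"
proof -
  have "matching E {}" by (simp add: matching_def)
  then obtain M where "matching E M" "\<forall>M'. matching E M' \<longrightarrow> M \<subseteq> M' \<longrightarrow> M = M'"
    using finite_has_maximal[OF finite_matchings] by auto
  then show ?thesis by (auto simp: maximal_matching_def)
qed

lemma min_maximal_matching_number_le:
  "maximal_matching E M \<Longrightarrow> min_maximal_matching_number E \<le> card M"
  unfolding min_maximal_matching_number_def
  by (rule Min_le) (auto intro: finite_maximal_matchings)

lemma min_maximal_matching_number_attained:
  obtains M where "maximal_matching E M" "card M = min_maximal_matching_number E"
proof -
  have "min_maximal_matching_number E \<in> card ` {M. maximal_matching E M}"
    unfolding min_maximal_matching_number_def
    using maximal_matching_exists by (intro Min_in finite_imageI finite_maximal_matchings) auto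
  then show ?thesis using that by auto
qed

section \<open>Vertex sets of matchings\<close>

lemma card_Union_matching:
  assumes "matching E M"
  shows "card (\<Union>M) = 2 * card M"
proof -
  have *: "card e = 2" if "e \<in> M" for e
    using that assms simple by (auto simp: matching_def simple_graph_def)
  then have "finite e" if "e \<in> M" for e
    using that by (metis card.infinite zero_neq_numeral)
  then have "card (\<Union>M) = sum card M"
    using assms by (intro card_Union_disjoint) (auto simp: matching_def)
  then show ?thesis using * by simp
qed

lemma matching_edge_partner:
  assumes "matching E M" "e \<in> M" "w \<in> e"
  shows "e = {w, partner M w}"
proof -
  have "card e = 2" using assms simple by (auto simp: matching_def simple_graph_def)
  then obtain x where "e = {w, x}"
    using assms(3) by (auto simp: card_2_iff doubleton_eq_iff)
  then show ?thesis using partner_eq assms by metis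
qed

lemma partner_partner:
  assumes "matching E M" "w \<in> \<Union>M"
  shows "partner M (partner M w) = w" "partner M w \<in> \<Union>M" "partner M w \<in> nbhd E w"
proof -
  obtain e where e: "e \<in> M" "w \<in> e" using assms(2) by auto
  then have "{w, partner M w} \<in> M" using matching_edge_partner[OF assms(1)] by metis
  then have *: "{partner M w, w} \<in> M" by (simp add: insert_commute)
  then show "partner M (partner M w) = w" by (rule partner_eq[OF assms(1)])
  show "partner M w \<in> \<Union>M" using * by auto
  show "partner M w \<in> nbhd E w" using * assms(1) by (auto simp: nbhd_def matching_def)
qed

lemma Union_matching_subset: "matching E M \<Longrightarrow> \<Union>M \<subseteq> V"
  using simple by (fastforce simp: matching_def simple_graph_def)

text \<open>An edge between two uncovered vertices could be added to \<open>M\<close>.\<close>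

lemma nbhd_subset_maximal_matching:
  assumes "maximal_matching E M" "z \<notin> \<Union>M"
  shows "nbhd E z \<subseteq> \<Union>M"
proof (rule ccontr)
  assume "\<not> ?thesis"
  then obtain u where u: "{u, z} \<in> E" "u \<notin> \<Union>M" by (auto simp: nbhd_def)
  have "matching E (insert {u, z} M)"
    using u assms by (auto simp: maximal_matching_def matching_def pairwise_insert disjnt_def)
  moreover have "M \<subset> insert {u, z} M" using u by auto
  ultimately show False using assms(1) by (auto simp: maximal_matching_def)
qed

text \<open>A covered vertex is dominated by its partner, an uncovered one by any of its neighbours,
  all of which are covered.\<close>

lemma maximal_matching_total_dominating:
  assumes "maximal_matching E M"
  shows "total_dominating V E (\<Union>M)"
proof -
  have m: "matching E M" using assms by (simp add: maximal_matching_def)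
  have "\<exists>u\<in>\<Union>M. u \<in> nbhd E v" if "v \<in> V" for v
  proof (cases "v \<in> \<Union>M")
    case True
    then show ?thesis using partner_partner(2,3)[OF m] by blast
  next
    case False
    then show ?thesis
      using nbhd_subset_maximal_matching[OF assms] nbhd_nonempty[OF that] by fastforce
  qed
  then show ?thesis using Union_matching_subset[OF m] by (auto simp: total_dominating_def)
qed

text \<open>Replaces the comparison of two minima by a property of a single matching, on which the
  combinatorial argument can work.\<close>

lemma total_domination_number_eq_iff:
  "total_domination_number V E = 2 * min_maximal_matching_number E \<longleftrightarrow>
    (\<exists>M. maximal_matching E M \<and> (\<forall>D. total_dominating V E D \<longrightarrow> card (\<Union>M) \<le> card D))"
  (is "?l \<longleftrightarrow> ?r")
proof
  assume l: ?l
  obtain M where M: "maximal_matching E M" "card M = min_maximal_matching_number E"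
    by (rule min_maximal_matching_number_attained)
  then have "card (\<Union>M) = total_domination_number V E"
    using l card_Union_matching by (auto simp: maximal_matching_def)
  then have "\<forall>D. total_dominating V E D \<longrightarrow> card (\<Union>M) \<le> card D"
    using total_domination_number_le by simp
  then show ?r using M(1) by blast
next
  assume ?r
  then obtain M where M: "maximal_matching E M"
    "\<And>D. total_dominating V E D \<Longrightarrow> card (\<Union>M) \<le> card D" by blast
  have card2: "card (\<Union>N) = 2 * card N" if "maximal_matching E N" for N
    using that card_Union_matching by (auto simp: maximal_matching_def)
  obtain D where D: "total_dominating V E D" "card D = total_domination_number V E"
    by (rule total_domination_number_attained)
  obtain N where N: "maximal_matching E N" "card N = min_maximal_matching_number E"
    by (rule min_maximal_matching_number_attained)
  \<comment> \<open>\<open>M\<close> is not assumed to be smallest, so its vertex set is squeezed: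
    the bounds run from twice the matching number through \<open>card (\<Union>M)\<close> to the
    total domination number, and back through the smallest \<open>N\<close>.\<close>
  have "2 * min_maximal_matching_number E \<le> card (\<Union>M)"
    using min_maximal_matching_number_le[OF M(1)] card2[OF M(1)] by simp
  also have "\<dots> \<le> total_domination_number V E"
    using M(2)[OF D(1)] D(2) by simp
  finally have "2 * min_maximal_matching_number E \<le> total_domination_number V E" .
  moreover have "total_domination_number V E \<le> 2 * min_maximal_matching_number E"
    using total_domination_number_le[OF maximal_matching_total_dominating[OF N(1)]]
      card2[OF N(1)] N(2) by simp
  ultimately show ?l by simp
qed

end

section \<open>Maximal matchings covering a minimum total dominating set\<close>

locale minimum_dominating_matching = graph_without_isolated +
  fixes M
  assumes maximal: "maximal_matching E M"
    and minimum: "total_dominating V E D \<Longrightarrow> card (\<Union>M) \<le> card D"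
begin

lemma matching_M: "matching E M"
  using maximal by (simp add: maximal_matching_def)

lemmas M_partner = partner_partner[OF matching_M]

lemma finite_Union_M: "finite (\<Union>M)"
  using Union_matching_subset[OF matching_M] finite_V finite_subset by blast

lemma total_dominating_M: "total_dominating V E (\<Union>M)"
  by (rule maximal_matching_total_dominating[OF maximal])

lemma supports_subset_M: "supports V E \<subseteq> \<Union>M"
  by (rule supports_subset_total_dominating[OF total_dominating_M])

text \<open>By minimality, removing \<open>y\<close> from the covered vertices leaves some
  \<open>z\<close> undominated; before the removal \<open>z\<close> was dominated, hence only by
  \<open>y\<close>.\<close>

lemma private_neighbour:
  assumes "y \<in> \<Union>M"
  obtains z where "z \<in> V" "nbhd E z \<inter> \<Union>M = {y}"
proof -
  have "card (\<Union>M - {y}) < card (\<Union>M)"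
    using assms finite_Union_M by (intro psubset_card_mono) auto
  then have "\<not> total_dominating V E (\<Union>M - {y})" using minimum by force
  then obtain z where "z \<in> V" "nbhd E z \<inter> (\<Union>M - {y}) = {}"
    using Union_matching_subset[OF matching_M] by (fastforce simp: total_dominating_def)
  moreover from this(1) have "nbhd E z \<inter> \<Union>M \<noteq> {}"
    using total_dominating_M by (fastforce simp: total_dominating_def)
  ultimately show ?thesis using that[of z] by blast
qed

text \<open>An uncovered private neighbour of \<open>y\<close> would be a leaf and make
  \<open>y\<close> a support. So the private neighbour is covered; its own partner is a covered
  neighbour, hence equals \<open>y\<close>.\<close>

lemma nbhd_partner:
  assumes "y \<in> \<Union>M" "y \<notin> supports V E"
  shows "nbhd E (partner M y) \<inter> \<Union>M = {y}"
proof -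
  obtain z where z: "z \<in> V" "nbhd E z \<inter> \<Union>M = {y}" using private_neighbour[OF assms(1)] .
  have zM: "z \<in> \<Union>M"
  proof (rule ccontr)
    assume "z \<notin> \<Union>M"
    then have "nbhd E z = {y}" using nbhd_subset_maximal_matching[OF maximal] z(2) by blast
    then show False using supports_nbhd_singleton z(1) assms(2) by blast
  qed
  then have "partner M z = y" using M_partner(2,3)[OF zM] z(2) by blast
  then have "z = partner M y" using M_partner(1)[OF zM] by simp
  then show ?thesis using z(2) by simp
qed

text \<open>If the partner were no support, \<open>nbhd_partner\<close> would make it the only
  covered neighbour of \<open>v\<close>; but \<open>v\<close> has a support as neighbour, and
  supports are covered.\<close>

lemma partner_supports_plus:
  assumes "v \<in> supports_plus V E"
  shows "partner M v \<in> supports_plus V E"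
proof -
  have v: "v \<in> supports V E" "v \<in> \<Union>M" using assms supports_subset_M
    by (auto simp: supports_plus_def)
  obtain u where u: "u \<in> supports V E" "u \<in> nbhd E v"
    using assms by (auto simp: supports_plus_def)
  have "partner M v \<in> supports V E"
  proof (rule ccontr)
    assume *: "partner M v \<notin> supports V E"
    then have "nbhd E v \<inter> \<Union>M = {partner M v}"
      using nbhd_partner[of "partner M v"] M_partner(1,2)[OF v(2)] by simp
    moreover have "u \<in> nbhd E v \<inter> \<Union>M" using u supports_subset_M by blast
    ultimately show False using u(1) * by simp
  qed
  then show ?thesis
    using v(1) M_partner(3)[OF v(2)] nbhd_sym unfolding supports_plus_def by fast
qed

lemma partner_supports_minus:
  assumes "v \<in> supports_minus V E"
  shows "partner M v \<in> V - supports V E"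
proof -
  have "v \<in> \<Union>M" using assms supports_subset_M by (auto simp: supports_minus_def)
  then have "partner M v \<in> nbhd E v" by (rule M_partner(3))
  then show ?thesis
    using assms nbhd_subset by (auto simp: supports_minus_def supports_plus_def)
qed

text \<open>Exchange argument: trading the two partners for \<open>x\<close> gives a set too small
  to be total dominating. A vertex \<open>w\<close> it misses has all its covered neighbours among
  the two partners.\<close>

lemma common_neighbour:
  assumes "u \<in> \<Union>M" "v \<in> \<Union>M" "u \<noteq> v"
    and "partner M u \<notin> supports V E" "partner M v \<notin> supports V E"
    and "x \<in> nbhd E u" "x \<in> nbhd E v"
  shows "\<exists>w\<in>V. nbhd E w = {partner M u, partner M v}"
proof -
  let ?T = "\<Union>M" and ?P = "{partner M u, partner M v}"
  have neq: "partner M u \<noteq> partner M v" using M_partner(1) assms(1-3) by metis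
  have P: "?P \<subseteq> ?T" using M_partner(2) assms(1,2) by blast
  have card_P: "card ?P = 2" using neq by simp
  have "card (?T - ?P) = card ?T - 2" using card_Diff_subset[OF _ P] card_P by simp
  then have "card (insert x (?T - ?P)) \<le> Suc (card ?T - 2)"
    using finite_Union_M by (simp add: card_insert_if)
  \<comment> \<open>Rules out truncation in \<open>card ?T - 2\<close>, so removing two vertices and
    adding at most one is a strict decrease.\<close>
  moreover have "2 \<le> card ?T" using card_mono[OF finite_Union_M P] card_P by simp
  ultimately have "card (insert x (?T - ?P)) < card ?T" by simp
  then have "\<not> total_dominating V E (insert x (?T - ?P))" using minimum by force
  moreover have "insert x (?T - ?P) \<subseteq> V"
    using Union_matching_subset[OF matching_M] nbhd_subset assms(6) by blast
  ultimately obtain w where w: "w \<in> V" "nbhd E w \<inter> insert x (?T - ?P) = {}"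
    by (fastforce simp: total_dominating_def)
  then have sub: "nbhd E w \<inter> ?T \<subseteq> ?P" by blast
  \<comment> \<open>A covered \<open>w\<close> has its partner in \<open>?P\<close>, so it is
    \<open>u\<close> or \<open>v\<close>; but both of these are dominated by
    \<open>x\<close>.\<close>
  have "w \<notin> ?T"
  proof
    assume wT: "w \<in> ?T"
    then have "partner M w \<in> ?P" using M_partner(2,3)[OF wT] sub by blast
    then have "w = u \<or> w = v" using M_partner(1) wT assms(1,2) by (metis empty_iff insert_iff)
    then show False using w(2) assms(6,7) by blast
  qed
  then have "nbhd E w \<subseteq> ?P" using nbhd_subset_maximal_matching[OF maximal] sub by blast
  \<comment> \<open>A single neighbour would be a support, so both partners occur.\<close>
  moreover have "nbhd E w \<noteq> {partner M u}" "nbhd E w \<noteq> {partner M v}"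
    using supports_nbhd_singleton w(1) assms(4,5) by blast+
  ultimately have "nbhd E w = ?P" using nbhd_nonempty[OF w(1)] by blast
  then show ?thesis using w(1) by blast
qed

end

section \<open>The characterization\<close>

text \<open>\<open>A\<close> abstracts the vertex set to which (iii) and (iv) apply. The proof
  compares \<open>\<Union>M - D\<close> with \<open>D - \<Union>M\<close> through an injection
  \<open>f\<close>.\<close>

lemma (in graph_without_isolated) card_matching_le_total_dominating:
  assumes M: "matching E M" and D: "total_dominating V E D"
    and partner_A: "\<And>w. w \<in> \<Union>M - supports V E \<Longrightarrow> partner M w \<in> A"
    and unique: "\<And>v. v \<in> A \<Longrightarrow> nbhd E v \<inter> \<Union>M = {partner M v}"
    and common: "\<And>u v. \<lbrakk>u \<in> A; v \<in> A; u \<noteq> v; nbhd E u \<inter> nbhd E v \<noteq> {}\<rbrakk>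
      \<Longrightarrow> \<exists>w\<in>V. nbhd E w = {partner M u, partner M v}"
  shows "card (\<Union>M) \<le> card D"
proof -
  have fin: "finite (\<Union>M)" "finite D"
    using finite_subset[OF Union_matching_subset[OF M] finite_V] finite_subset[OF _ finite_V] D
    by (simp_all add: total_dominating_def)
  have "\<forall>w\<in>\<Union>M. \<exists>x\<in>D. x \<in> nbhd E (partner M w)"
    using D Union_matching_subset[OF M] partner_partner(2)[OF M]
    unfolding total_dominating_def by blast
  then obtain f where f: "\<And>w. w \<in> \<Union>M \<Longrightarrow> f w \<in> D \<and> f w \<in> nbhd E (partner M w)" by metis
  \<comment> \<open>\<open>D\<close> contains all supports, so a vertex outside \<open>D\<close> is
    a non-support and \<open>partner_A\<close> applies.\<close>
  have A: "partner M w \<in> A" "partner M (partner M w) = w" if "w \<in> \<Union>M - D" for w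
    using that partner_A[of w] supports_subset_total_dominating[OF D] partner_partner(1)[OF M, of w]
    by auto
  have "inj_on f (\<Union>M - D)"
  proof (rule inj_onI, rule ccontr)
    fix w w' assume w: "w \<in> \<Union>M - D" "w' \<in> \<Union>M - D" "f w = f w'" "w \<noteq> w'"
    \<comment> \<open>The value \<open>f w = f w'\<close> is a common neighbour of the two partners.
      Then \<open>common\<close> yields a vertex \<open>z\<close> with neighbourhood
      \<open>{w, w'}\<close>, which misses \<open>D\<close>.\<close>
    have "nbhd E (partner M w) \<inter> nbhd E (partner M w') \<noteq> {}" using f[of w] f[of w'] w by auto
    moreover have "partner M w \<noteq> partner M w'" using A(2)[OF w(1)] A(2)[OF w(2)] w(4) by auto
    ultimately obtain z where z: "z \<in> V" "nbhd E z = {w, w'}"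
      using common[OF A(1)[OF w(1)] A(1)[OF w(2)]] A(2)[OF w(1)] A(2)[OF w(2)] by auto
    obtain d where "d \<in> D" "d \<in> nbhd E z" using D z(1) by (auto simp: total_dominating_def)
    then show False using z(2) w(1,2) by auto
  qed
  moreover have "f ` (\<Union>M - D) \<subseteq> D - \<Union>M"
  proof
    fix x assume "x \<in> f ` (\<Union>M - D)"
    then obtain w where w: "w \<in> \<Union>M - D" "x = f w" by blast
    \<comment> \<open>The only covered neighbour of the partner is \<open>w\<close>, which lies
      outside \<open>D\<close>; hence the dominator \<open>f w\<close> is uncovered.\<close>
    have "nbhd E (partner M w) \<inter> \<Union>M = {w}" using unique A[OF w(1)] by metis
    moreover have "f w \<noteq> w" using f[of w] w(1) by auto
    ultimately show "x \<in> D - \<Union>M" using f[of w] w by blast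
  qed
  moreover have "finite (D - \<Union>M)" using fin by simp
  ultimately have "card (\<Union>M - D) \<le> card (D - \<Union>M)" by (rule card_inj_on_le)
  then show ?thesis
    using card_Int_Diff[OF fin(1), of D] card_Int_Diff[OF fin(2), of "\<Union>M"]
    by (simp add: Int_commute)
qed

theorem theorem2p5:
  fixes V :: "'a set" and E :: "'a set set"
  assumes "simple_graph V E" and "V \<noteq> {}"
    and "1 \<le> min_degree V E" and "min_degree V E \<le> 2"
  shows "total_domination_number V E = 2 * min_maximal_matching_number E \<longleftrightarrow>
    (\<exists>M Mplus Mminus Mstar.
      maximal_matching E M \<and> M = Mplus \<union> Mminus \<union> Mstar \<and>
      perfect_matching (supports_plus V E) (induced_edges E (supports_plus V E)) Mplus \<and>
      supports_minus V E \<subseteq> \<Union>Mminus \<and>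
      (\<forall>e\<in>Mminus. \<exists>x\<in>supports_minus V E. \<exists>y\<in>V - supports V E. e = {x, y}) \<and>
      (\<forall>v\<in>supports_minus V E \<union> \<Union>Mstar. nbhd E v \<inter> \<Union>M = {partner M v}) \<and>
      (\<forall>u\<in>supports_minus V E \<union> \<Union>Mstar. \<forall>v\<in>supports_minus V E \<union> \<Union>Mstar.
        u \<noteq> v \<and> nbhd E u \<inter> nbhd E v \<noteq> {} \<longrightarrow>
        (\<exists>w\<in>V. nbhd E w = {partner M u, partner M v})))"
  (is "_ \<longleftrightarrow> ?r")
proof -
  have "1 \<le> card (nbhd E v)" if "v \<in> V" for v
  proof -
    have "finite V" using assms(1) by (simp add: simple_graph_def)
    then have "min_degree V E \<le> vdegree E v"
      unfolding min_degree_def using that by (intro Min_le) auto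
    then show ?thesis using assms(3) by (simp add: vdegree_def)
  qed
  then interpret graph_without_isolated V E
    using assms(1) by unfold_locales force+
  have "(\<exists>M. maximal_matching E M \<and> (\<forall>D. total_dominating V E D \<longrightarrow> card (\<Union>M) \<le> card D)) \<longleftrightarrow> ?r"
    (is "?l \<longleftrightarrow> _")
  proof
    assume ?l
    then obtain M where M: "maximal_matching E M"
      "\<And>D. total_dominating V E D \<Longrightarrow> card (\<Union>M) \<le> card D" by blast
    interpret minimum_dominating_matching V E M by unfold_locales (use M in auto)
    let ?p = "supports_plus V E" and ?m = "supports_minus V E"
    \<comment> \<open>Edges are sorted by the supports they contain. The three classes exhaust
      \<open>M\<close> because an edge with one end in \<open>?p\<close> has both ends
      there.\<close>
    define Mp where "Mp = {e \<in> M. e \<subseteq> ?p}"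
    define Mm where "Mm = {e \<in> M. e \<inter> ?m \<noteq> {}}"
    define Ms where "Ms = {e \<in> M. e \<inter> supports V E = {}}"
    have supp: "supports V E = ?p \<union> ?m" by (auto simp: supports_plus_def supports_minus_def)
    have edge: "e = {w, partner M w}" if "e \<in> M" "w \<in> e" for e w
      using matching_edge_partner[OF matching_M that] .
    have plus_edge: "e \<subseteq> ?p" if "e \<in> M" "w \<in> e" "w \<in> ?p" for e w
      by (subst edge[OF that(1,2)]) (use partner_supports_plus[OF that(3)] that(3) in simp)
    have parts: "M = Mp \<union> Mm \<union> Ms"
    proof
      show "M \<subseteq> Mp \<union> Mm \<union> Ms"
      proof
        fix e assume "e \<in> M"
        then show "e \<in> Mp \<union> Mm \<union> Ms"
          using plus_edge[of e] supp unfolding Mp_def Mm_def Ms_def by blast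
      qed
    qed (auto simp: Mp_def Mm_def Ms_def)
    have plus: "perfect_matching ?p (induced_edges E ?p) Mp"
    proof -
      have "matching (induced_edges E ?p) Mp"
        using matching_M
        by (auto simp: matching_def Mp_def induced_edges_def pairwise_def)
      moreover have "\<Union>Mp = ?p"
      proof
        show "?p \<subseteq> \<Union>Mp"
        proof
          fix v assume v: "v \<in> ?p"
          then obtain e where "e \<in> M" "v \<in> e" using supports_subset_M supp by blast
          then show "v \<in> \<Union>Mp" using plus_edge[OF _ _ v] unfolding Mp_def by blast
        qed
      qed (auto simp: Mp_def)
      ultimately show ?thesis by (simp add: perfect_matching_def)
    qed
    have minus: "?m \<subseteq> \<Union>Mm" using supports_subset_M supp unfolding Mm_def by blast
    have Mm_edge: "\<forall>e\<in>Mm. \<exists>x\<in>?m. \<exists>y\<in>V - supports V E. e = {x, y}"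
    proof
      fix e assume "e \<in> Mm"
      then obtain x where x: "e \<in> M" "x \<in> e" "x \<in> ?m" by (auto simp: Mm_def)
      show "\<exists>x\<in>?m. \<exists>y\<in>V - supports V E. e = {x, y}"
        by (rule bexI[of _ x], rule bexI[of _ "partner M x"])
          (fact edge[OF x(1,2)] partner_supports_minus[OF x(3)] x(3))+
    qed
    \<comment> \<open>Provides the non-support hypotheses of \<open>nbhd_partner\<close> and
      \<open>common_neighbour\<close>, which concern the partner of \<open>v\<close> and not
      \<open>v\<close> itself.\<close>
    have A: "v \<in> \<Union>M \<and> partner M v \<in> \<Union>M - supports V E" if v: "v \<in> ?m \<union> \<Union>Ms" for v
    proof -
      have "v \<in> \<Union>M" using v supports_subset_M supp unfolding Ms_def by blast
      moreover have "partner M v \<notin> supports V E"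
      proof (cases "v \<in> ?m")
        case True
        then show ?thesis using partner_supports_minus by blast
      next
        case False
        then obtain e where e: "e \<in> M" "v \<in> e" "e \<inter> supports V E = {}"
          using v unfolding Ms_def by blast
        have "partner M v \<in> e" by (subst edge[OF e(1,2)]) simp
        then show ?thesis using e(3) by blast
      qed
      ultimately show ?thesis using M_partner(2) by blast
    qed
    have unique: "\<forall>v\<in>?m \<union> \<Union>Ms. nbhd E v \<inter> \<Union>M = {partner M v}"
    proof
      fix v assume "v \<in> ?m \<union> \<Union>Ms"
      from A[OF this] show "nbhd E v \<inter> \<Union>M = {partner M v}"
        using nbhd_partner[of "partner M v"] M_partner(1)[of v] by simp
    qed
    have common: "\<forall>u\<in>?m \<union> \<Union>Ms. \<forall>v\<in>?m \<union> \<Union>Ms. u \<noteq> v \<and> nbhd E u \<inter> nbhd E v \<noteq> {} \<longrightarrow>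
        (\<exists>w\<in>V. nbhd E w = {partner M u, partner M v})"
    proof (intro ballI impI)
      fix u v assume u: "u \<in> ?m \<union> \<Union>Ms" and v: "v \<in> ?m \<union> \<Union>Ms"
        and uv: "u \<noteq> v \<and> nbhd E u \<inter> nbhd E v \<noteq> {}"
      then obtain x where "x \<in> nbhd E u" "x \<in> nbhd E v" by blast
      with A[OF u] A[OF v] uv show "\<exists>w\<in>V. nbhd E w = {partner M u, partner M v}"
        by (intro common_neighbour[of u v x]) simp_all
    qed
    show ?r
      by (intro exI[of _ M] exI[of _ Mp] exI[of _ Mm] exI[of _ Ms] conjI)
        (fact maximal parts plus minus Mm_edge unique common)+
  next
    assume ?r
    then obtain M Mp Mm Ms where max: "maximal_matching E M" and MU: "M = Mp \<union> Mm \<union> Ms"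
      and plus: "perfect_matching (supports_plus V E) (induced_edges E (supports_plus V E)) Mp"
      and minus: "\<forall>e\<in>Mm. \<exists>x\<in>supports_minus V E. \<exists>y\<in>V - supports V E. e = {x, y}"
      and unique: "\<forall>v\<in>supports_minus V E \<union> \<Union>Ms. nbhd E v \<inter> \<Union>M = {partner M v}"
      and common: "\<forall>u\<in>supports_minus V E \<union> \<Union>Ms. \<forall>v\<in>supports_minus V E \<union> \<Union>Ms.
        u \<noteq> v \<and> nbhd E u \<inter> nbhd E v \<noteq> {} \<longrightarrow>
        (\<exists>w\<in>V. nbhd E w = {partner M u, partner M v})"
      by (elim exE conjE) (rule that)
    have m: "matching E M" using max by (simp add: maximal_matching_def)
    \<comment> \<open>A covered non-support is not covered by \<open>Mp\<close>. On an edge of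
      \<open>Mm\<close> it is the end outside the supports, so its partner is in
      \<open>supports_minus V E\<close>; on an edge of \<open>Ms\<close> both ends qualify.\<close>
    have A: "partner M w \<in> supports_minus V E \<union> \<Union>Ms" if w: "w \<in> \<Union>M - supports V E" for w
    proof -
      obtain e where e: "e \<in> M" "w \<in> e" using w by blast
      have eq: "e = {w, partner M w}" by (rule matching_edge_partner[OF m e])
      have "w \<notin> \<Union>Mp" using w plus by (auto simp: perfect_matching_def supports_plus_def)
      then consider "e \<in> Mm" | "e \<in> Ms" using e MU by blast
      then show ?thesis
      proof cases
        case 1
        then obtain x y where xy: "x \<in> supports_minus V E" "e = {x, y}" using minus by blast
        have "x \<noteq> w" using xy(1) w by (auto simp: supports_minus_def)
        moreover have "{w, partner M w} = {x, y}" using eq xy(2) by (rule subst)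
        ultimately have "partner M w = x" by (auto simp: doubleton_eq_iff)
        then show ?thesis using xy(1) by simp
      next
        case 2
        moreover have "partner M w \<in> e" by (subst eq) simp
        ultimately show ?thesis by blast
      qed
    qed
    have "card (\<Union>M) \<le> card D" if "total_dominating V E D" for D
      by (rule card_matching_le_total_dominating[OF m that A])
        (use unique common in blast)+
    then show ?l using max by blast
  qed
  then show ?thesis using total_domination_number_eq_iff by simp
qed

end
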